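(* Let $\mathcal A=\{a_1,\dots,a_m\}$ ($m\ge2$) be an alphabet ordered by $a_1<a_2<\cdots<a_m$ and, for $1\le i\le m$, let $\mathcal B_i=\{a_i,\dots,a_m\}$. An episturmian word $\mathbf w$ over $\mathcal A$ is an infinite Lyndon word if and only if there exists an integer $j$ with $1\le j<m$ such that the normalized directive word of $\mathbf w$ belongs to \[ (\bar{\mathcal B}_2^*a_1)^*\cdots(\bar{\mathcal B}_j^*a_{j-1})^*(\bar{\mathcal B}_{j+1}^*a_j)^*(\bar{\mathcal B}_{j+1}^+\{a_j\}^+)^\omega, \] where $\bar{\mathcal B}_i=\{\bar x: x\in\mathcal B_i\}$.
   Context: For $a\in\mathcal A$, $L_a,R_a$ are the morphisms with $L_a(a)=R_a(a)=a$, $L_a(b)=ab$, $R_a(b)=ba$ ($b\ne a$). Spinned words are words over $\mathcal A\cup\bar{\mathcal A}$, $\bar{\mathcal A}=\{\bar x:x\in\mathcal A\}$ (unbarred letters spin $L$, barred spin $R$); $\mu_a=L_a$, $\mu_{\bar a}=R_a$. An infinite word is episturmian if its set of factors is closed under reversal and it has at most one right special factor of each length. A spinned infinite word $\breve x_1\breve x_2\cdots$ directs $\mathbf t$ if there are recurrent infinite words $\mathbf t^{(n)}$ with $\mathbf t^{(0)}=\mathbf t$ and $\mathbf t^{(n-1)}=\mu_{\breve x_n}(\mathbf t^{(n)})$ for $n\ge1$. A normalized directive word is a directive word with infinitely many $L$-spinned letters and no factor in $\bigcup_{a\in\mathcal A}\bar a\bar{\mathcal A}^*a$ (unique for aperiodic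 episturmian words). The lexicographic order on words is induced by the order on $\mathcal A$; an infinite word $\mathbf w$ is an infinite Lyndon word if it is strictly lexicographically smaller than each of its proper suffixes. *)

theory Defs
  imports Main "HOL-Library.Stream"
begin

text \<open>Infinite words over \<open>A\<close> are the elements of \<^term>\<open>streams A\<close>, finite words those of
  \<^term>\<open>lists A\<close>.\<close>

definition factors :: "'a stream \<Rightarrow> 'a list set" where
  "factors w = {stake n (sdrop i w) | n i. True}"

definition recurrent :: "'a stream \<Rightarrow> bool" where
  "recurrent w \<longleftrightarrow> (\<forall>u\<in>factors w. infinite {i. stake (length u) (sdrop i w) = u})"

definition right_special :: "'a stream \<Rightarrow> 'a list \<Rightarrow> bool" where
  "right_special w u \<longleftrightarrow> (\<exists>x y. x \<noteq> y \<and> u @ [x] \<in> factors w \<and> u @ [y] \<in> factors w)"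

definition episturmian :: "'a stream \<Rightarrow> bool" where
  "episturmian w \<longleftrightarrow>
     (\<forall>u\<in>factors w. rev u \<in> factors w) \<and>
     (\<forall>u v. right_special w u \<longrightarrow> right_special w v \<longrightarrow> length u = length v \<longrightarrow> u = v)"

definition lex_less :: "'a::linorder stream \<Rightarrow> 'a stream \<Rightarrow> bool" where
  "lex_less u v \<longleftrightarrow> (\<exists>n. stake n u = stake n v \<and> u !! n < v !! n)"

text \<open>A proper suffix is one starting at a position \<open>k > 0\<close>, even if it happens to equal the whole
  word; hence purely periodic words are not Lyndon.\<close>

definition infinite_lyndon :: "'a::linorder stream \<Rightarrow> bool" where
  "infinite_lyndon w \<longleftrightarrow> (\<forall>k>0. lex_less w (sdrop k w))"

text \<open>\<open>Unbarred x\<close> is the letter $x$ with spin $L$, \<open>Barred x\<close> is $\bar x$ with spin $R$.\<close>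

datatype 'a spinned = Unbarred 'a | Barred 'a

definition spinned_alphabet :: "'a set \<Rightarrow> 'a spinned set" where
  "spinned_alphabet A = Unbarred ` A \<union> Barred ` A"

definition L_morph :: "'a \<Rightarrow> 'a \<Rightarrow> 'a list" where
  "L_morph a b = (if b = a then [a] else [a, b])"

definition R_morph :: "'a \<Rightarrow> 'a \<Rightarrow> 'a list" where
  "R_morph a b = (if b = a then [a] else [b, a])"

fun mu :: "'a spinned \<Rightarrow> 'a \<Rightarrow> 'a list" where
  "mu (Unbarred a) = L_morph a"
| "mu (Barred a) = R_morph a"

text \<open>Action of a non-erasing morphism, given by its values on letters, on an infinite word.\<close>

definition apply_morph :: "('a \<Rightarrow> 'b list) \<Rightarrow> 'a stream \<Rightarrow> 'b stream" where
  "apply_morph f w = flat (smap f w)"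

text \<open>Streams are indexed from 0, so \<open>\<Delta> !! n\<close> is the letter $\breve x_{n+1}$.\<close>

definition directs :: "'a set \<Rightarrow> 'a spinned stream \<Rightarrow> 'a stream \<Rightarrow> bool" where
  "directs A \<Delta> t \<longleftrightarrow>
     \<Delta> \<in> streams (spinned_alphabet A) \<and>
     (\<exists>T :: nat \<Rightarrow> 'a stream.
        T 0 = t \<and>
        (\<forall>n. T n \<in> streams A \<and> recurrent (T n)) \<and>
        (\<forall>n. T n = apply_morph (mu (\<Delta> !! n)) (T (Suc n))))"

definition normalized_directive :: "'a set \<Rightarrow> 'a spinned stream \<Rightarrow> 'a stream \<Rightarrow> bool" where
  "normalized_directive A \<Delta> t \<longleftrightarrow>
     directs A \<Delta> t \<and>
     infinite {n. \<Delta> !! n \<in> Unbarred ` A} \<and>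
     (\<forall>a\<in>A. \<forall>v\<in>lists (Barred ` A). [Barred a] @ v @ [Unbarred a] \<notin> factors \<Delta>)"

definition lang_conc :: "'a list set \<Rightarrow> 'a list set \<Rightarrow> 'a list set" where
  "lang_conc K M = {u @ v | u v. u \<in> K \<and> v \<in> M}"

definition lang_star :: "'a list set \<Rightarrow> 'a list set" where
  "lang_star K = concat ` lists K"

definition lang_omega :: "'a list set \<Rightarrow> 'a stream set" where
  "lang_omega K = flat ` streams (K - {[]})"

definition lang_shift :: "'a list set \<Rightarrow> 'a stream set \<Rightarrow> 'a stream set" where
  "lang_shift K W = {u @- x | u x. u \<in> K \<and> x \<in> W}"

definition barred_from :: "(nat \<Rightarrow> 'a) \<Rightarrow> nat \<Rightarrow> nat \<Rightarrow> 'a spinned set" where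
  "barred_from a m i = Barred ` a ` {i..m}"

text \<open>The language $(\bar{\mathcal B}_{i+1}^* a_i)^*$.\<close>

definition lyndon_block :: "(nat \<Rightarrow> 'a) \<Rightarrow> nat \<Rightarrow> nat \<Rightarrow> 'a spinned list set" where
  "lyndon_block a m i = lang_star (lang_conc (lists (barred_from a m (i + 1))) {[Unbarred (a i)]})"

text \<open>The set $(\bar{\mathcal B}_2^*a_1)^*\cdots(\bar{\mathcal B}_{j+1}^*a_j)^*
  (\bar{\mathcal B}_{j+1}^+\{a_j\}^+)^\omega$.\<close>

definition lyndon_directives :: "(nat \<Rightarrow> 'a) \<Rightarrow> nat \<Rightarrow> nat \<Rightarrow> 'a spinned stream set" where
  "lyndon_directives a m j =
     lang_shift
       (foldr lang_conc (map (lyndon_block a m) [1..<j + 1]) {[]})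
       (lang_omega
         (lang_conc (lists (barred_from a m (j + 1)) - {[]}) (lists {Unbarred (a j)} - {[]})))"

end

theory Submission
  imports Defs "HOL-Library.Infinite_Set"
begin

text \<open>Both \<open>L\<close> and \<open>R\<close> preserve the strict lexicographic order, so the Lyndon property passes from an
  image to its preimage. A Lyndon episturmian word starts with its smallest letter \<open>y\<close> and has a
  unique right special letter \<open>x\<close>, which occurs in every factor of length two. If \<open>x = y\<close> the word is
  an image under \<open>L\<close>, otherwise \<open>x > y\<close> and it is an image under \<open>R\<close>; the preimage is again a Lyndon
  episturmian word. Iterating, the unbarred directive letters are nondecreasing and each barred letter
  exceeds the next unbarred one, which is the shape of the language. Conversely, for such a directive
  word a suffix violating the Lyndon property desubstitutes to one at the next level whose starting
  position has not grown and has decreased at every barred letter, which cannot go on forever.\<close>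

section \<open>Infinite words, factors and recurrence\<close>

lemma stream_eq_iff_snth: "s = t \<longleftrightarrow> (\<forall>n. s !! n = t !! n)"
  using smap_alt[of id s t] by (simp add: stream.map_id)

lemma sdrop_eq_shift_append:
  assumes "sdrop i w = u @- v @- s"
  shows "sdrop (i + length u) w = v @- s"
  using arg_cong[OF assms, of "sdrop (length u)"] by (simp add: sdrop_shift)

lemma stake_length_shift: "stake (length u) (u @- s) = u"
  by (simp add: stake_shift)

lemma factors_iff: "u \<in> factors w \<longleftrightarrow> (\<exists>i s. sdrop i w = u @- s)"
proof
  assume "u \<in> factors w"
  then obtain n i where "u = stake n (sdrop i w)" by (auto simp: factors_def)
  then have "sdrop i w = u @- sdrop n (sdrop i w)" by (simp only: stake_sdrop)
  then show "\<exists>i s. sdrop i w = u @- s" by blast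
next
  assume "\<exists>i s. sdrop i w = u @- s"
  then obtain i s where "sdrop i w = u @- s" by blast
  then have "u = stake (length u) (sdrop i w)" by (simp add: stake_length_shift)
  then show "u \<in> factors w" unfolding factors_def by blast
qed

lemma factorsI: "sdrop i w = u @- s \<Longrightarrow> u \<in> factors w"
  by (auto simp: factors_iff)

lemma factors_append:
  assumes "u @ v \<in> factors w"
  shows "u \<in> factors w" and "v \<in> factors w"
proof -
  obtain i s where occ: "sdrop i w = u @- v @- s"
    using assms by (auto simp: factors_iff)
  then show "u \<in> factors w" by (rule factorsI)
  show "v \<in> factors w" using sdrop_eq_shift_append[OF occ] by (rule factorsI)
qed

lemma recurrentI:
  assumes "\<And>u N. u \<in> factors w \<Longrightarrow> \<exists>i\<ge>N. \<exists>s. sdrop i w = u @- s"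
  shows "recurrent w"
  unfolding recurrent_def infinite_nat_iff_unbounded_le
proof (intro ballI allI)
  fix u N assume "u \<in> factors w"
  from assms[OF this, of N] obtain i s where "i \<ge> N" "sdrop i w = u @- s" by blast
  then show "\<exists>n\<ge>N. n \<in> {i. stake (length u) (sdrop i w) = u}"
    by (auto simp: stake_length_shift intro!: exI[of _ i])
qed

lemma recurrentD:
  assumes "recurrent w" "u \<in> factors w"
  shows "\<exists>i\<ge>N. \<exists>s. sdrop i w = u @- s"
proof -
  from assms obtain i where "i \<ge> N" "stake (length u) (sdrop i w) = u"
    unfolding recurrent_def infinite_nat_iff_unbounded_le by blast
  then show ?thesis by (metis stake_sdrop)
qed

text \<open>Take a prefix of \<open>w\<close> that contains \<open>u\<close> and continues for
  \<open>N\<close> more letters. In its reversal \<open>rev u\<close> is preceded by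
  \<open>N\<close> letters, so wherever that reversal occurs, \<open>rev u\<close> starts at
  position at least \<open>N\<close>.\<close>

lemma rev_factor_late:
  assumes closed: "\<forall>u\<in>factors w. rev u \<in> factors w" and u: "u \<in> factors w"
  shows "\<exists>i\<ge>N. \<exists>s. sdrop i w = rev u @- s"
proof -
  obtain i s where occ: "sdrop i w = u @- s" using u by (auto simp: factors_iff)
  define v where "v = stake i w @ u @ stake N s"
  have "sdrop 0 w = v @- sdrop N s"
    by (simp add: v_def stake_sdrop occ[symmetric])
  then have "rev v \<in> factors w" using closed factorsI by blast
  then obtain k s' where "sdrop k w = rev (stake N s) @- rev u @- rev (stake i w) @- s'"
    by (auto simp: factors_iff v_def)
  from sdrop_eq_shift_append[OF this] show ?thesis
    by (intro exI[of _ "k + N"]) auto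
qed

lemma episturmian_recurrent:
  assumes "episturmian w"
  shows "recurrent w"
proof (rule recurrentI)
  fix u N assume u: "u \<in> factors w"
  have closed: "\<forall>u\<in>factors w. rev u \<in> factors w"
    using assms by (simp add: episturmian_def)
  show "\<exists>i\<ge>N. \<exists>s. sdrop i w = u @- s"
    using rev_factor_late[OF closed, of "rev u" N] closed u by simp
qed

text \<open>Common form of the descent arguments below: \<open>n\<close> is a level of
  desubstitution, \<open>k\<close> a position in the word of that level. Strong induction on
  \<open>k\<close> walks to the next level satisfying \<open>S\<close>, where the position has to
  drop.\<close>

lemma no_infinite_descent:
  fixes Q :: "nat \<Rightarrow> nat \<Rightarrow> bool"
  assumes step: "\<And>n k. Q n k \<Longrightarrow> \<exists>k'\<le>k. Q (Suc n) k' \<and> (S n \<longrightarrow> k' < k)"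
    and inf: "\<And>n. \<exists>N\<ge>n. S N"
  shows "\<not> Q n k"
proof (induction k arbitrary: n rule: less_induct)
  case (less k)
  obtain N where "n \<le> N" "S N" using inf by blast
  then show ?case using less
  proof (induction arbitrary: k rule: inc_induct)
    case base
    then show ?case using step by blast
  next
    case (step i)
    then show ?case using assms(1)[of i k]
      by (metis le_eq_less_or_eq order.strict_trans1)
  qed
qed

text \<open>\<open>W\<close> is an invariant of the tails that remain after cutting off a block;
  iterating one choice of block and tail yields the coding stream. The lemma serves both to decode
  images under \<open>R_morph\<close> and to cut a directive word into the blocks of an omega
  power.\<close>

lemma flat_smap_unfoldI:
  assumes step: "\<And>s. s \<in> W \<Longrightarrow> \<exists>c\<in>C. h c \<noteq> [] \<and> (\<exists>s'\<in>W. s = h c @- s')"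
    and s: "s \<in> W"
  shows "\<exists>t\<in>streams C. s = flat (smap h t)"
proof -
  obtain c r where cr: "\<And>s. s \<in> W \<Longrightarrow> c s \<in> C \<and> h (c s) \<noteq> [] \<and> r s \<in> W \<and> s = h (c s) @- r s"
    using step by metis
  define t where "t s = smap c (siterate r s)" for s
  have t_unfold: "t s = c s ## t (r s)" for s
    by (simp add: t_def siterate.ctr[of r s])
  have W: "(r ^^ n) s \<in> W" if "s \<in> W" for n s
    using that cr by (induction n) auto
  have "s !! n = flat (smap h (t s)) !! n" if "s \<in> W" for s n
    using that
  proof (induction n arbitrary: s rule: less_induct)
    case (less n)
    have s: "s = h (c s) @- r s" and ne: "h (c s) \<noteq> []" and r: "r s \<in> W"
      using cr less.prems by auto
    have f: "flat (smap h (t s)) = h (c s) @- flat (smap h (t (r s)))"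
      by (subst t_unfold) (simp add: ne)
    show ?case
    proof (cases "n < length (h (c s))")
      case True
      then show ?thesis by (subst s, subst f) simp
    next
      case False
      then have "n - length (h (c s)) < n" using ne by (cases "h (c s)") auto
      from less.IH[OF this r] False show ?thesis by (subst s, subst f) simp
    qed
  qed
  moreover have "t s \<in> streams C"
    using W[OF s] cr by (auto simp: t_def streams_iff_snth)
  ultimately show ?thesis using s by (auto simp: stream_eq_iff_snth)
qed

section \<open>The morphisms \<open>L\<close> and \<open>R\<close>\<close>

abbreviation R_list :: "'a \<Rightarrow> 'a list \<Rightarrow> 'a list" where
  "R_list x u \<equiv> concat (map (R_morph x) u)"

abbreviation R_stream :: "'a \<Rightarrow> 'a stream \<Rightarrow> 'a stream" where
  "R_stream x s \<equiv> apply_morph (R_morph x) s"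

lemma R_morph_simps [simp]:
  "R_morph x x = [x]" "c \<noteq> x \<Longrightarrow> R_morph x c = [c, x]" "R_morph x c \<noteq> []"
  by (auto simp: R_morph_def)

lemma hd_R_morph [simp]: "hd (R_morph x c) = c"
  by (simp add: R_morph_def)

lemma R_stream_Cons [simp]: "R_stream x (c ## s) = R_morph x c @- R_stream x s"
  by (simp add: apply_morph_def)

lemma R_stream_shift [simp]: "R_stream x (u @- s) = R_list x u @- R_stream x s"
  by (induction u) auto

lemma shd_R_stream [simp]: "shd (R_stream x s) = shd s"
  by (cases s) simp

text \<open>Through this identity every statement about \<open>L\<close> reduces to one about \<open>R\<close>.\<close>

lemma L_stream: "apply_morph (L_morph x) s = x ## R_stream x s"
proof -
  have "apply_morph (L_morph x) s !! n = (x ## R_stream x s) !! n" for n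
  proof (induction n arbitrary: s rule: less_induct)
    case (less n)
    obtain c s' where s: "s = c ## s'" by (cases s)
    have L: "apply_morph (L_morph x) s = L_morph x c @- apply_morph (L_morph x) s'"
      by (simp add: s apply_morph_def L_morph_def)
    \<comment> \<open>Conjugacy on letters: \<open>x # R_morph x c = L_morph x c @ [x]\<close>, so
      the leading \<open>x\<close> moves past one block.\<close>
    have R: "x ## R_stream x s = L_morph x c @- (x ## R_stream x s')"
      by (simp add: s L_morph_def)
    show ?case
    proof (cases "n < length (L_morph x c)")
      case True
      then show ?thesis unfolding L R by simp
    next
      case False
      then have "n - length (L_morph x c) < n" by (auto simp: L_morph_def split: if_splits)
      from less.IH[OF this, of s'] False show ?thesis unfolding L R by simp
    qed
  qed
  then show ?thesis by (simp add: stream_eq_iff_snth)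
qed

lemma mu_stream:
  "apply_morph (mu (Unbarred x)) s = x ## R_stream x s"
  "apply_morph (mu (Barred x)) s = R_stream x s"
  by (simp_all add: L_stream)

text \<open>\<open>x # R_list x u\<close> is also the L-image of \<open>u\<close> followed by
  \<open>x\<close>, and reversal exchanges the two morphisms. This symmetric padding is why factors
  of a preimage are encoded below as \<open>x # R_list x u\<close>.\<close>

lemma rev_R_list: "rev (x # R_list x u) = x # R_list x (rev u)"
proof (induction u)
  case (Cons c u)
  then show ?case by (cases "c = x") auto
qed simp

text \<open>The block of a letter begins with that letter, so the first letter read determines the
  whole block and decoding from left to right is deterministic.\<close>

lemma R_list_inject_prefix: "R_list x u @- s = R_stream x t \<Longrightarrow> \<exists>t'. t = u @- t' \<and> s = R_stream x t'"
proof (induction u arbitrary: t)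
  case (Cons c u)
  obtain d t1 where t: "t = d ## t1" by (cases t)
  have "shd (R_list x (c # u) @- s) = shd (R_stream x t)" using Cons.prems by simp
  then have "c = d" by (simp add: t)
  then have "R_list x u @- s = R_stream x t1" using Cons.prems by (simp add: t)
  from Cons.IH[OF this] show ?case by (auto simp: t \<open>c = d\<close>)
qed auto

lemma R_list_prefixD: "R_list x u @ s = R_list x v \<Longrightarrow> \<exists>v'. v = u @ v'"
proof (induction u arbitrary: v)
  case (Cons c u)
  then obtain d v1 where v: "v = d # v1" by (cases v) auto
  have "hd (R_list x (c # u) @ s) = hd (R_list x v)" using Cons.prems by simp
  then have "c = d" by (simp add: v)
  then have "R_list x u @ s = R_list x v1" using Cons.prems by (simp add: v)
  from Cons.IH[OF this] show ?case by (auto simp: v \<open>c = d\<close>)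
qed auto

lemma sdrop_apply_morph:
  assumes ne: "\<And>c. f c \<noteq> []"
  shows "sdrop (length (concat (map f (stake k s)))) (apply_morph f s) = apply_morph f (sdrop k s)"
proof -
  have "apply_morph f (u @- t) = concat (map f u) @- apply_morph f t" for u t
    by (induction u) (auto simp: apply_morph_def ne)
  then have "apply_morph f s = concat (map f (stake k s)) @- apply_morph f (sdrop k s)"
    by (metis stake_sdrop)
  then show ?thesis by (simp add: sdrop_shift)
qed

lemma mu_neq_Nil: "mu \<sigma> c \<noteq> []"
  by (cases \<sigma>) (auto simp: L_morph_def R_morph_def)

lemma length_concat_map_ge:
  assumes "\<And>c. f c \<noteq> []"
  shows "length u \<le> length (concat (map f u))"
proof (induction u)
  case (Cons c u)
  then show ?case using assms[of c] by (cases "f c") auto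
qed simp

text \<open>A position in an R-image is either a block boundary or the trailing \<open>x\<close> of
  a block \<open>[c, x]\<close>; in the second case \<open>q\<close> points to the letter after
  \<open>c\<close>. The bounds on \<open>q\<close> drive the descents: blocks are nonempty, and a
  first letter other than \<open>x\<close> has a block of length two, which makes
  \<open>q < p\<close>.\<close>

lemma sdrop_R_stream:
  "(\<exists>q\<le>p. sdrop p (R_stream x s) = R_stream x (sdrop q s) \<and>
      (p > 0 \<longrightarrow> q > 0) \<and> (p > 0 \<longrightarrow> shd s \<noteq> x \<longrightarrow> q < p)) \<or>
   (\<exists>q\<le>p. 0 < q \<and> sdrop p (R_stream x s) = x ## R_stream x (sdrop q s))"
proof (induction p arbitrary: s rule: less_induct)
  case (less p)
  obtain c t where s: "s = c ## t" by (cases s)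
  consider "p = 0" | "p = 1" "c \<noteq> x" | "p > 0" "c = x \<or> p > 1" by linarith
  then show ?case
  proof cases
    case 1
    then show ?thesis by (intro disjI1 exI[of _ 0]) simp
  next
    case 2
    then show ?thesis by (intro disjI2 exI[of _ 1]) (simp add: s)
  next
    case 3
    define p' where "p' = (if c = x then p - 1 else p - 2)"
    have p': "p' < p" "c \<noteq> x \<longrightarrow> Suc p' < p" using 3 by (auto simp: p'_def)
    have "sdrop (Suc p') (R_stream x s) = sdrop p' (R_stream x t)" if "c = x"
      using that by (simp add: s)
    moreover have "sdrop (Suc (Suc p')) (R_stream x s) = sdrop p' (R_stream x t)" if "c \<noteq> x"
      using that by (simp add: s)
    moreover have "p = (if c = x then Suc p' else Suc (Suc p'))"
      using 3 by (auto simp: p'_def)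
    ultimately have e: "sdrop p (R_stream x s) = sdrop p' (R_stream x t)" by presburger
    from less.IH[OF p'(1), of t] show ?thesis
    proof
      assume "\<exists>q\<le>p'. sdrop p' (R_stream x t) = R_stream x (sdrop q t) \<and>
        (p' > 0 \<longrightarrow> q > 0) \<and> (p' > 0 \<longrightarrow> shd t \<noteq> x \<longrightarrow> q < p')"
      then obtain q where "q \<le> p'" "sdrop p' (R_stream x t) = R_stream x (sdrop q t)" by blast
      then show ?thesis using p' unfolding e by (intro disjI1 exI[of _ "Suc q"]) (auto simp: s)
    next
      assume "\<exists>q\<le>p'. 0 < q \<and> sdrop p' (R_stream x t) = x ## R_stream x (sdrop q t)"
      then obtain q where "q \<le> p'" "sdrop p' (R_stream x t) = x ## R_stream x (sdrop q t)" by blast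
      then show ?thesis using p' unfolding e by (intro disjI2 exI[of _ "Suc q"]) (auto simp: s)
    qed
  qed
qed

text \<open>A letter other than \<open>x\<close> never closes a block of length two, so it sits at a
  block boundary.\<close>

lemma R_stream_letter:
  assumes "R_stream x s !! p = c" "c \<noteq> x"
  shows "\<exists>q\<le>p. s !! q = c \<and> (p > 0 \<longrightarrow> q > 0) \<and> (p > 0 \<longrightarrow> shd s \<noteq> x \<longrightarrow> q < p)"
proof -
  have c: "shd (sdrop p (R_stream x s)) = c" using assms(1) by simp
  from sdrop_R_stream[of p x s] show ?thesis
  proof
    assume "\<exists>q\<le>p. 0 < q \<and> sdrop p (R_stream x s) = x ## R_stream x (sdrop q s)"
    then have "shd (sdrop p (R_stream x s)) = x" by (elim exE conjE) simp
    then show ?thesis using c assms(2) by simp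
  next
    assume "\<exists>q\<le>p. sdrop p (R_stream x s) = R_stream x (sdrop q s) \<and>
      (p > 0 \<longrightarrow> q > 0) \<and> (p > 0 \<longrightarrow> shd s \<noteq> x \<longrightarrow> q < p)"
    then obtain q where "q \<le> p" "sdrop p (R_stream x s) = R_stream x (sdrop q s)"
      "p > 0 \<longrightarrow> q > 0" "p > 0 \<longrightarrow> shd s \<noteq> x \<longrightarrow> q < p" by blast
    then show ?thesis using c by (intro exI[of _ q]) simp
  qed
qed

lemma sset_R_stream: "sset s \<subseteq> sset (R_stream x s)"
proof
  fix c assume "c \<in> sset s"
  then obtain k where k: "c = s !! k" by (auto simp: sset_range)
  have "shd (R_stream x (sdrop k s)) = c" by (simp add: k)
  then have "R_stream x s !! (length (R_list x (stake k s))) = c"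
    by (simp add: sdrop_apply_morph[symmetric])
  then show "c \<in> sset (R_stream x s)" using snth_sset by metis
qed

text \<open>Every letter other than \<open>x\<close> is followed by \<open>x\<close>, so the word
  can be cut greedily into blocks \<open>[x]\<close> and \<open>[c, x]\<close>; the hypothesis
  passes to all tails.\<close>

lemma R_stream_preimage:
  assumes "\<And>i. s !! i = x \<or> s !! Suc i = x"
  shows "\<exists>t. s = R_stream x t"
proof -
  let ?W = "{s. \<forall>i. s !! i = x \<or> s !! Suc i = x}"
  have "\<exists>t\<in>streams UNIV. s = flat (smap (R_morph x) t)"
  proof (rule flat_smap_unfoldI[of ?W])
    fix s assume "s \<in> ?W"
    then have W: "s !! i = x \<or> s !! Suc i = x" for i by simp
    show "\<exists>c\<in>UNIV. R_morph x c \<noteq> [] \<and> (\<exists>s'\<in>?W. s = R_morph x c @- s')"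
    proof (cases "shd s = x")
      case True
      have "stl s \<in> ?W" using W[of "Suc _"] by simp
      then show ?thesis using True
        by (intro bexI[of _ x] conjI bexI[of _ "stl s"]) auto
    next
      case False
      have "stl (stl s) \<in> ?W" using W[of "Suc (Suc _)"] by simp
      moreover have "shd (stl s) = x" using False W[of 0] by simp
      then have "s = R_morph x (shd s) @- stl (stl s)"
        using False by simp (metis stream.collapse)
      ultimately show ?thesis
        by (intro bexI[of _ "shd s"] conjI bexI[of _ "stl (stl s)"]) auto
    qed
  qed (use assms in simp)
  then show ?thesis by (auto simp: apply_morph_def)
qed

section \<open>Lexicographic order and Lyndon words\<close>

lemma lex_less_iff:
  "lex_less s t \<longleftrightarrow> (\<exists>p c d s' t'. s = p @- c ## s' \<and> t = p @- d ## t' \<and> c < d)"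
proof
  assume "lex_less s t"
  then obtain n where "stake n s = stake n t" "s !! n < t !! n" by (auto simp: lex_less_def)
  then show "\<exists>p c d s' t'. s = p @- c ## s' \<and> t = p @- d ## t' \<and> c < d"
    by (metis id_stake_snth_sdrop)
next
  assume "\<exists>p c d s' t'. s = p @- c ## s' \<and> t = p @- d ## t' \<and> c < d"
  then obtain p c d s' t' where "s = p @- c ## s'" "t = p @- d ## t'" "c < d" by blast
  then show "lex_less s t"
    unfolding lex_less_def by (intro exI[of _ "length p"]) (simp add: stake_length_shift)
qed

lemma lex_less_asym: "lex_less s t \<Longrightarrow> \<not> lex_less t s"
proof
  assume "lex_less s t" "lex_less t s"
  then obtain n k where n: "stake n s = stake n t" "s !! n < t !! n"
    and k: "stake k t = stake k s" "t !! k < s !! k" by (auto simp: lex_less_def)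
  have "s !! i = t !! i" if "i < n \<or> i < k" for i
    using that n(1) k(1) stake_nth by metis
  then show False using n(2) k(2) by (metis less_asym' less_irrefl linorder_neqE_nat)
qed

lemma lex_less_total: "s = t \<or> lex_less s t \<or> lex_less t s"
proof (cases "s = t")
  case False
  then have ex: "\<exists>n. s !! n \<noteq> t !! n" by (simp add: stream_eq_iff_snth)
  define n where "n = (LEAST n. s !! n \<noteq> t !! n)"
  have ne: "s !! n \<noteq> t !! n" using LeastI_ex[OF ex] by (simp add: n_def)
  have "s !! i = t !! i" if "i < n" for i using not_less_Least[of i] that by (auto simp: n_def)
  then have "stake n s = stake n t" by (intro nth_equalityI) simp_all
  then show ?thesis using ne unfolding lex_less_def by (metis neqE)
qed simp

lemma lex_less_shd: "shd s < shd t \<Longrightarrow> lex_less s t"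
  by (auto simp: lex_less_def intro!: exI[of _ 0])

lemma lex_less_Stream: "lex_less (x ## s) (x ## t)" if "lex_less s t"
proof -
  from that obtain p c d s' t' where "s = p @- c ## s'" "t = p @- d ## t'" "c < d"
    by (auto simp: lex_less_iff)
  then have "x ## s = (x # p) @- c ## s'" "x ## t = (x # p) @- d ## t'" "c < d" by auto
  then show ?thesis unfolding lex_less_iff by blast
qed

text \<open>The blocks of the first differing letters \<open>c\<close> and \<open>d\<close> start
  with \<open>c\<close> and \<open>d\<close> themselves, so the images first differ there and in the
  same direction.\<close>

lemma lex_less_R_stream:
  assumes "lex_less s t"
  shows "lex_less (R_stream x s) (R_stream x t)"
proof -
  obtain p c d s' t' where eqs: "s = p @- c ## s'" "t = p @- d ## t'" and "c < d"
    using assms by (auto simp: lex_less_iff)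
  have "R_morph x c = c # tl (R_morph x c)" "R_morph x d = d # tl (R_morph x d)"
    by (simp_all add: R_morph_def)
  then have "R_stream x s = R_list x p @- c ## tl (R_morph x c) @- R_stream x s'"
    "R_stream x t = R_list x p @- d ## tl (R_morph x d) @- R_stream x t'"
    using eqs by (metis R_stream_Cons R_stream_shift shift.simps(2))+
  then show ?thesis using \<open>c < d\<close> unfolding lex_less_iff by blast
qed

lemma lex_less_mu:
  "lex_less s t \<Longrightarrow> lex_less (apply_morph (mu \<sigma>) s) (apply_morph (mu \<sigma>) t)"
  by (cases \<sigma>) (auto simp: L_stream intro: lex_less_R_stream lex_less_Stream)

text \<open>A proper suffix of \<open>t\<close> maps to a proper suffix of the image. Since the
  order is total, a morphism that preserves it strictly also reflects it.\<close>

lemma infinite_lyndon_mu_preimage: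
  assumes "infinite_lyndon (apply_morph (mu \<sigma>) t)"
  shows "infinite_lyndon t"
  unfolding infinite_lyndon_def
proof (intro allI impI)
  fix k :: nat assume "k > 0"
  define k' where "k' = length (concat (map (mu \<sigma>) (stake k t)))"
  have "k' > 0" using \<open>k > 0\<close> length_concat_map_ge[of "mu \<sigma>" "stake k t"]
    by (simp add: k'_def mu_neq_Nil)
  then have "lex_less (apply_morph (mu \<sigma>) t) (sdrop k' (apply_morph (mu \<sigma>) t))"
    using assms by (simp add: infinite_lyndon_def)
  also have "sdrop k' (apply_morph (mu \<sigma>) t) = apply_morph (mu \<sigma>) (sdrop k t)"
    unfolding k'_def by (rule sdrop_apply_morph) (rule mu_neq_Nil)
  finally show "lex_less t (sdrop k t)"
    using lex_less_total[of t "sdrop k t"] lex_less_mu lex_less_asym by metis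
qed

lemma infinite_lyndon_shd_le:
  assumes "infinite_lyndon w"
  shows "shd w \<le> w !! k"
proof (cases "k = 0")
  case False
  then have "lex_less w (sdrop k w)" using assms by (simp add: infinite_lyndon_def)
  then show ?thesis using lex_less_shd[of "sdrop k w" w] lex_less_asym by (force simp: not_le[symmetric])
qed simp

section \<open>Desubstitution of episturmian words\<close>

lemma right_special_suffix: "right_special w (p @ u) \<Longrightarrow> right_special w u"
  unfolding right_special_def using factors_append(2) by (metis append.assoc)

lemma pair_factor: "[w !! i, w !! Suc i] \<in> factors w"
  by (rule factorsI[of i _ _ "sdrop (Suc (Suc i)) w"])
    (metis One_nat_def id_stake_snth_sdrop sdrop_simps shift.simps stream.collapse)

text \<open>A letter that is not right special has only one successor. Closure under reversal
  identifies the successor of the second letter as the first one, so the two letters alternate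
  forever.\<close>

lemma alternating_tail:
  assumes "episturmian w" and nrs: "\<not> right_special w [w !! i]" "\<not> right_special w [w !! Suc i]"
  shows "(w !! (i + k) = w !! i \<and> w !! Suc (i + k) = w !! Suc i) \<or>
         (w !! (i + k) = w !! Suc i \<and> w !! Suc (i + k) = w !! i)"
proof (induction k)
  case (Suc k)
  have bc: "[w !! i, w !! Suc i] \<in> factors w" by (rule pair_factor)
  then have cb: "[w !! Suc i, w !! i] \<in> factors w"
    using assms(1) unfolding episturmian_def by force
  have *: "[w !! Suc (i + k), w !! Suc (Suc (i + k))] \<in> factors w" by (rule pair_factor)
  show ?case using Suc.IH
  proof (elim disjE conjE)
    assume e: "w !! (i + k) = w !! i" "w !! Suc (i + k) = w !! Suc i"
    then have "w !! Suc (Suc (i + k)) = w !! i"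
      using nrs(2) * cb unfolding right_special_def append_Cons append_Nil by metis
    then show ?thesis using e by simp
  next
    assume e: "w !! (i + k) = w !! Suc i" "w !! Suc (i + k) = w !! i"
    then have "w !! Suc (Suc (i + k)) = w !! Suc i"
      using nrs(1) * bc unfolding right_special_def append_Cons append_Nil by metis
    then show ?thesis using e by simp
  qed
qed simp

lemma separating_letter:
  assumes epi: "episturmian w" and lyn: "infinite_lyndon w"
  obtains x where "\<And>i. w !! i = x \<or> w !! Suc i = x"
proof -
  \<comment> \<open>Otherwise \<open>w\<close> would have period two and equal its proper suffix
    \<open>sdrop 2 w\<close>, which the Lyndon property excludes.\<close>
  have "right_special w [w !! 0] \<or> right_special w [w !! Suc 0]"
  proof (rule ccontr)
    assume "\<not> ?thesis"
    then have alt: "(w !! k = w !! 0 \<and> w !! Suc k = w !! Suc 0) \<or>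
         (w !! k = w !! Suc 0 \<and> w !! Suc k = w !! 0)" for k
      using alternating_tail[OF epi, of 0 k] by simp
    have "w !! Suc (Suc k) = w !! k" for k using alt[of k] alt[of "Suc k"] by metis
    then have "sdrop 2 w = w"
      by (simp add: stream_eq_iff_snth numeral_2_eq_2 sdrop_snth)
    moreover have "lex_less w (sdrop 2 w)" using lyn by (simp add: infinite_lyndon_def)
    ultimately show False using lex_less_asym by metis
  qed
  then obtain x where x: "right_special w [x]" by blast
  then have rs: "right_special w [y] \<longleftrightarrow> y = x" for y
    using epi unfolding episturmian_def by (metis length_Cons list.inject)
  have "w !! i = x \<or> w !! Suc i = x" for i
  proof (rule ccontr)
    assume *: "\<not> ?thesis"
    \<comment> \<open>A pair avoiding \<open>x\<close> would start an alternating tail without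
      \<open>x\<close>, while recurrence makes \<open>x\<close> occur arbitrarily late.\<close>
    obtain y where "[x] @ [y] \<in> factors w" using x by (auto simp: right_special_def)
    then obtain k s where "k \<ge> i" "sdrop k w = [x] @- s"
      using recurrentD[OF episturmian_recurrent[OF epi]] factors_append(1) by metis
    then have "w !! (i + (k - i)) = x" by (metis le_add_diff_inverse sdrop_simps(1) shift.simps stream.sel(1))
    then show False using alternating_tail[OF epi, of i "k - i"] * rs by metis
  qed
  then show thesis by (rule that)
qed

lemma R_stream_separated: "R_stream x s !! i = x \<or> R_stream x s !! Suc i = x"
proof -
  have "shd (sdrop i (R_stream x s)) = x \<or> shd (stl (sdrop i (R_stream x s))) = x"
    using sdrop_R_stream[of i x s]
  proof (elim disjE exE conjE)
    fix q assume e: "sdrop i (R_stream x s) = R_stream x (sdrop q s)"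
    obtain c t where "sdrop q s = c ## t" by (cases "sdrop q s")
    then show ?thesis unfolding e by (cases "c = x") simp_all
  qed auto
  then show ?thesis by simp
qed

text \<open>The leading \<open>x\<close> synchronizes the decoding: whether it is a block of its own
  or closes a longer block, what follows it starts at a block boundary.\<close>

lemma R_stream_factor_decode:
  assumes "sdrop p (R_stream x t) = x ## R_list x u @- s"
  shows "u \<in> factors t"
proof -
  obtain q where "R_list x u @- s = R_stream x (sdrop q t)"
    using sdrop_R_stream[of p x t]
  proof (elim disjE exE conjE)
    fix q assume e: "sdrop p (R_stream x t) = R_stream x (sdrop q t)"
    obtain c t' where t': "sdrop q t = c ## t'" by (cases "sdrop q t")
    have "c = x" using arg_cong[OF e, of shd] assms by (simp add: t')
    then have "R_list x u @- s = R_stream x (sdrop (Suc q) t)"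
      using e assms t' by (metis R_morph_simps(1) R_stream_Cons sdrop_simps(2) shift.simps stream.sel(2))
    then show thesis by (rule that)
  next
    fix q assume "sdrop p (R_stream x t) = x ## R_stream x (sdrop q t)"
    then have "R_list x u @- s = R_stream x (sdrop q t)" using assms by simp
    then show thesis by (rule that)
  qed
  from R_list_inject_prefix[OF this] show ?thesis by (auto intro: factorsI)
qed

lemma factors_L_preimage:
  assumes w: "w = x ## R_stream x t"
  shows "u \<in> factors t \<longleftrightarrow> x # R_list x u \<in> factors w"
proof
  assume "u \<in> factors t"
  then obtain i s where i: "sdrop i t = u @- s" by (auto simp: factors_iff)
  have "w = apply_morph (mu (Unbarred x)) t" by (simp only: w mu_stream)
  then have "sdrop (length (concat (map (mu (Unbarred x)) (stake i t)))) w =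
      apply_morph (mu (Unbarred x)) (sdrop i t)"
    by (simp only: sdrop_apply_morph[OF mu_neq_Nil])
  also have "\<dots> = (x # R_list x u) @- R_stream x s" unfolding mu_stream i by simp
  finally show "x # R_list x u \<in> factors w" by (rule factorsI)
next
  assume "x # R_list x u \<in> factors w"
  then obtain p s where p: "sdrop p w = x ## R_list x u @- s" by (auto simp: factors_iff)
  show "u \<in> factors t"
  proof (cases p)
    \<comment> \<open>Here the leading \<open>x\<close> is the letter placed in front of
      \<open>R_stream x t\<close>, not a letter of that stream.\<close>
    case 0
    then have "R_list x u @- s = R_stream x t" using p w by simp
    from R_list_inject_prefix[OF this] show ?thesis by (auto intro: factorsI[of 0])
  next
    case (Suc p')
    then show ?thesis using p w by (intro R_stream_factor_decode[of p' x t u s]) simp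
  qed
qed

text \<open>The difficulty is a prefix of \<open>t\<close>, whose image at position 0 has no
  \<open>x\<close> before it. The image of a prefix starts with a letter other than
  \<open>x\<close>; by recurrence it occurs again later, and there it must be preceded by
  \<open>x\<close>.\<close>

lemma factors_R_preimage:
  assumes w: "w = R_stream x t" and rec: "recurrent w" and "shd t \<noteq> x"
  shows "u \<in> factors t \<longleftrightarrow> x # R_list x u \<in> factors w"
proof
  assume "u \<in> factors t"
  then obtain i s where i: "sdrop i t = u @- s" by (auto simp: factors_iff)
  define p where "p = stake i t"
  obtain c s' where s: "s = c ## s'" by (cases s)
  \<comment> \<open>The extra letter \<open>c\<close> keeps \<open>v\<close> nonempty even if
    \<open>p\<close> and \<open>u\<close> are empty.\<close>
  define v where "v = p @ u @ [c]"
  have t: "t = v @- s'" unfolding v_def p_def using stake_sdrop[of i t] i s by simp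
  have "v \<noteq> []" by (simp add: v_def)
  then obtain d v' where v: "v = d # v'" by (cases v) auto
  have "d \<noteq> x" using assms(3) t v by simp
  have "sdrop 0 w = R_list x v @- R_stream x s'" using w t by simp
  then have "R_list x v \<in> factors w" by (rule factorsI)
  from recurrentD[OF rec this, of 1] obtain k r where k: "k \<ge> 1" "sdrop k w = R_list x v @- r"
    by blast
  then obtain k' where k': "k = Suc k'" by (cases k) auto
  have "w !! Suc k' = d"
    using arg_cong[OF k(2), of shd] \<open>d \<noteq> x\<close> by (simp add: k' v)
  then have "w !! k' = x" using R_stream_separated[of x t k'] \<open>d \<noteq> x\<close> w by auto
  then have "sdrop k' w = (x # R_list x v) @- r"
    using k(2) k' by (metis sdrop_simps shift.simps(2) stream.collapse)
  then have "x # R_list x v \<in> factors w" by (rule factorsI)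
  \<comment> \<open>The padded image of \<open>p\<close> ends in \<open>x\<close>, and this
    \<open>x\<close> is the padding of the image of \<open>u\<close> inside that of
    \<open>v\<close>.\<close>
  moreover have "x # R_list x p = rev (R_list x (rev p)) @ [x]"
    using arg_cong[OF rev_R_list[of x p], of rev] by simp
  then have "x # R_list x v = rev (R_list x (rev p)) @ (x # R_list x u) @ R_morph x c"
    unfolding v_def by simp
  ultimately show "x # R_list x u \<in> factors w" using factors_append by metis
next
  assume "x # R_list x u \<in> factors w"
  then obtain p s where "sdrop p w = x ## R_list x u @- s" by (auto simp: factors_iff)
  then show "u \<in> factors t" using w by (intro R_stream_factor_decode[of p x t u s]) simp
qed

text \<open>Padding commutes with reversal, and since the block of \<open>c\<close> starts with
  \<open>c\<close>, right special factors of \<open>t\<close> have right special padded images in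
  \<open>w\<close>. It remains to recover uniqueness, although factors of equal length may have
  images of different lengths.\<close>

lemma episturmian_preimage:
  assumes epi: "episturmian w"
    and fac: "\<And>u. u \<in> factors t \<longleftrightarrow> x # R_list x u \<in> factors w"
  shows "episturmian t"
  unfolding episturmian_def
proof (intro conjI ballI allI impI)
  fix u assume "u \<in> factors t"
  then have "rev (x # R_list x u) \<in> factors w"
    using epi fac unfolding episturmian_def by blast
  then show "rev u \<in> factors t" unfolding rev_R_list fac .
next
  have rs: "right_special w (x # R_list x u)" if r: "right_special t u" for u
  proof -
    obtain c d where "c \<noteq> d" "u @ [c] \<in> factors t" "u @ [d] \<in> factors t"
      using r unfolding right_special_def by blast
    moreover have "(x # R_list x u) @ [c] \<in> factors w" if "u @ [c] \<in> factors t" for c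
    proof -
      have "R_morph x c = [c] @ tl (R_morph x c)" by (simp add: R_morph_def)
      then have "x # R_list x (u @ [c]) = ((x # R_list x u) @ [c]) @ tl (R_morph x c)" by simp
      then show ?thesis using that factors_append(1) unfolding fac by metis
    qed
    ultimately show ?thesis unfolding right_special_def by blast
  qed
  have *: "u = v" if u: "right_special t u" and v: "right_special t v"
    and len: "length u = length v" "length (R_list x u) \<le> length (R_list x v)" for u v
  proof -
    \<comment> \<open>\<open>q\<close> is the suffix of the padded image of \<open>v\<close> that is
      as long as the padded image of \<open>u\<close>. It is again right special, so the two agree;
      after reversal suffixes become prefixes, which can be decoded.\<close>
    define n where "n = length (R_list x v) - length (R_list x u)"
    define p q where "p = take n (x # R_list x v)" and "q = drop n (x # R_list x v)"
    have pq: "x # R_list x v = p @ q" unfolding p_def q_def by simp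
    have "length q = length (x # R_list x u)"
      using len(2) by (simp add: q_def n_def del: length_concat)
    moreover have "right_special w q"
      using rs[OF v] right_special_suffix unfolding pq by blast
    ultimately have "q = x # R_list x u"
      using epi rs[OF u] unfolding episturmian_def by blast
    then have "x # R_list x (rev v) = x # R_list x (rev u) @ rev p"
      using rev_R_list[of x v] rev_R_list[of x u] unfolding pq by (metis append_Cons rev_append)
    then obtain v' where "rev v = rev u @ v'" using R_list_prefixD[of x "rev u" "rev p" "rev v"] by auto
    then show "u = v" using len(1) by (metis append_Nil2 append_eq_append_conv length_rev rev_rev_ident)
  qed
  fix u v assume "right_special t u" "right_special t v" "length u = length v"
  then show "u = v" using *[of u v] *[of v u] by (metis nat_le_linear)
qed

lemma episturmian_lyndon_step:
  fixes w :: "'a::linorder stream"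
  assumes epi: "episturmian w" and lyn: "infinite_lyndon w" and A: "w \<in> streams A"
  shows "\<exists>\<sigma> t. w = apply_morph (mu \<sigma>) t \<and> t \<in> streams A \<and> episturmian t \<and> infinite_lyndon t \<and>
    (\<sigma> = Unbarred (shd w) \<or> (\<exists>x\<in>A. shd w < x \<and> \<sigma> = Barred x \<and> shd t = shd w))"
proof -
  obtain x where x: "\<And>i. w !! i = x \<or> w !! Suc i = x" using separating_letter[OF epi lyn] by blast
  show ?thesis
  proof (cases "shd w = x")
    case True
    have "stl w !! i = x \<or> stl w !! Suc i = x" for i using x[of "Suc i"] by simp
    then obtain t where "stl w = R_stream x t" using R_stream_preimage by metis
    then have w: "w = x ## R_stream x t" using True stream.collapse[of w] by metis
    then have \<sigma>: "w = apply_morph (mu (Unbarred x)) t" by (simp only: mu_stream)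
    have "sset t \<subseteq> sset w" unfolding w using sset_R_stream[of t x] by auto
    then have "t \<in> streams A" using A by (auto simp: streams_iff_sset)
    moreover have "episturmian t"
      by (rule episturmian_preimage[OF epi factors_L_preimage[OF w]])
    moreover have "infinite_lyndon t" using infinite_lyndon_mu_preimage lyn \<sigma> by metis
    ultimately show ?thesis using \<sigma> True by (intro exI[of _ "Unbarred x"] exI[of _ t]) simp
  next
    case False
    obtain t where w: "w = R_stream x t" using R_stream_preimage x by metis
    then have \<sigma>: "w = apply_morph (mu (Barred x)) t" by (simp only: mu_stream)
    have shd: "shd t = shd w" by (simp add: w)
    have "sset t \<subseteq> sset w" unfolding w by (rule sset_R_stream)
    then have "t \<in> streams A" using A by (auto simp: streams_iff_sset)
    moreover have "episturmian t"
      by (rule episturmian_preimage[OF epi factors_R_preimage[OF w]])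
        (use False shd episturmian_recurrent[OF epi] in simp_all)
    moreover have "infinite_lyndon t" using infinite_lyndon_mu_preimage lyn \<sigma> by metis
    \<comment> \<open>As \<open>w\<close> does not start with \<open>x\<close>, its second letter is
      \<open>x\<close>, and the first letter of a Lyndon word is minimal.\<close>
    moreover have "w !! Suc 0 = x" using x[of 0] False by simp
    then have "shd w < x" "x \<in> A"
      using infinite_lyndon_shd_le[OF lyn, of "Suc 0"] False snth_in[OF A, of "Suc 0"] by auto
    ultimately show ?thesis using \<sigma> shd by blast
  qed
qed

section \<open>The directive language\<close>

text \<open>The witness \<open>g\<close> for \<open>\<Delta>\<close> gives at level \<open>n\<close> the index of the next unbarred letter, which is the
  first and smallest letter of the word directed by \<open>sdrop n \<Delta>\<close>.\<close>

definition directive_index :: "(nat \<Rightarrow> 'a) \<Rightarrow> nat \<Rightarrow> 'a spinned stream \<Rightarrow> (nat \<Rightarrow> nat) \<Rightarrow> bool" where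
  "directive_index a m \<Delta> g \<longleftrightarrow>
     (\<forall>n. 1 \<le> g n \<and> g n \<le> m \<and> g n \<le> g (Suc n) \<and>
        (\<Delta> !! n = Unbarred (a (g n)) \<or>
         \<Delta> !! n \<in> barred_from a m (g n + 1) \<and> g (Suc n) = g n)) \<and>
     (\<forall>n. \<exists>N\<ge>n. \<exists>x. \<Delta> !! N = Barred x) \<and>
     (\<forall>n. \<exists>N\<ge>n. \<exists>x. \<Delta> !! N = Unbarred x)"

section \<open>From the directive language to index functions\<close>

lemma lang_concI: "u \<in> K \<Longrightarrow> v \<in> M \<Longrightarrow> u @ v \<in> lang_conc K M"
  by (auto simp: lang_conc_def)

lemma lang_concE:
  assumes "w \<in> lang_conc K M"
  obtains u v where "w = u @ v" "u \<in> K" "v \<in> M"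
  using assms by (auto simp: lang_conc_def)

lemma infinitely_often_Stream:
  assumes "\<And>n. \<exists>N\<ge>n. P (s !! N)"
  shows "\<exists>N\<ge>n. P ((c ## s) !! N)"
proof -
  obtain N where "N \<ge> n" "P (s !! N)" using assms by blast
  then show ?thesis by (intro exI[of _ "Suc N"]) simp
qed

lemma directive_index_Unbarred:
  assumes di: "directive_index a m \<Delta> g" and k: "1 \<le> k" "k \<le> g 0"
  shows "directive_index a m (Unbarred (a k) ## \<Delta>) (case_nat k g)"
proof -
  have "k \<le> m" using di k(2) unfolding directive_index_def by (meson order_trans)
  then show ?thesis
    using di k unfolding directive_index_def
    by (intro conjI allI infinitely_often_Stream) (auto split: nat.split)
qed

lemma directive_index_Barred:
  assumes di: "directive_index a m \<Delta> g" and b: "b \<in> barred_from a m (g 0 + 1)"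
  shows "directive_index a m (b ## \<Delta>) (case_nat (g 0) g)"
  using di b unfolding directive_index_def
  by (intro conjI allI infinitely_often_Stream) (auto split: nat.split)

lemma directive_index_chunk:
  assumes "u \<in> lists (barred_from a m (i + 1))" "directive_index a m \<Delta> g" "1 \<le> i" "i \<le> g 0"
  shows "\<exists>g'. directive_index a m (u @- Unbarred (a i) ## \<Delta>) g' \<and> g' 0 = i"
  using assms(1)
proof (induction u)
  case Nil
  then show ?case using directive_index_Unbarred[OF assms(2-4)] by auto
next
  case (Cons b u)
  then obtain g' where "directive_index a m (u @- Unbarred (a i) ## \<Delta>) g'" "g' 0 = i" by auto
  with directive_index_Barred[OF this(1), of b] Cons.hyps show ?case by auto
qed

lemma directive_index_block:
  assumes "u \<in> lyndon_block a m i" and di: "directive_index a m \<Delta> g" "i \<le> g 0" and i: "1 \<le> i"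
  shows "\<exists>g'. directive_index a m (u @- \<Delta>) g' \<and> i \<le> g' 0"
proof -
  obtain us where u: "u = concat us"
    and "us \<in> lists (lang_conc (lists (barred_from a m (i + 1))) {[Unbarred (a i)]})"
    using assms(1) by (auto simp: lyndon_block_def lang_star_def)
  from this(2) have "\<exists>g'. directive_index a m (concat us @- \<Delta>) g' \<and> i \<le> g' 0"
  proof (induction us)
    case Nil
    then show ?case using di by auto
  next
    case (Cons c us)
    then obtain v where c: "c = v @ [Unbarred (a i)]" and v: "v \<in> lists (barred_from a m (i + 1))"
      by (auto simp: lang_conc_def)
    obtain g' where "directive_index a m (concat us @- \<Delta>) g'" "i \<le> g' 0"
      using Cons.IH by blast
    from directive_index_chunk[OF v this(1) i this(2)] show ?case by (auto simp: c)
  qed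
  then show ?thesis by (simp only: u)
qed

text \<open>For \<open>i = j + 1\<close> no block is left and only the bound \<open>j\<close> on the
  tail is available; hence \<open>min i j\<close>.\<close>

lemma directive_index_blocks:
  assumes di: "directive_index a m \<Delta> g" "j \<le> g 0" and i: "1 \<le> i" "i \<le> j + 1"
    and u: "u \<in> foldr lang_conc (map (lyndon_block a m) [i..<j + 1]) {[]}"
  shows "\<exists>g'. directive_index a m (u @- \<Delta>) g' \<and> min i j \<le> g' 0"
  using i(2,1) u
proof (induction arbitrary: u rule: inc_induct)
  case base
  then show ?case using di by auto
next
  case (step i)
  then have "u \<in> lang_conc (lyndon_block a m i)
      (foldr lang_conc (map (lyndon_block a m) [Suc i..<j + 1]) {[]})"
    by (simp add: upt_conv_Cons del: upt_Suc)
  then obtain u1 u2 where u: "u = u1 @ u2" and u1: "u1 \<in> lyndon_block a m i"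
    and u2: "u2 \<in> foldr lang_conc (map (lyndon_block a m) [Suc i..<j + 1]) {[]}"
    by (rule lang_concE)
  obtain g' where g': "directive_index a m (u2 @- \<Delta>) g'" "min (Suc i) j \<le> g' 0"
    using step.IH[OF _ u2] by auto
  have "i \<le> g' 0" using g'(2) step.hyps by simp
  from directive_index_block[OF u1 g'(1) this step.prems(1)] show ?case
    by (auto simp: u)
qed

lemma flat_infinitely_often:
  assumes "\<And>v. v \<in> sset s \<Longrightarrow> \<exists>c\<in>set v. P c"
  shows "\<exists>N\<ge>n. P (flat s !! N)"
  using assms
proof (induction n arbitrary: s rule: less_induct)
  case (less n)
  have ex: "\<exists>c\<in>set (shd s). P c" by (rule less.prems[OF shd_sset])
  then have ne: "shd s \<noteq> []" by auto
  then have f: "flat s = shd s @- flat (stl s)" by (rule flat_unfold)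
  show ?case
  proof (cases "n = 0")
    case True
    obtain k where "k < length (shd s)" "P (shd s ! k)"
      using ex by (auto simp: in_set_conv_nth)
    then show ?thesis using True by (subst f) (auto intro!: exI[of _ k])
  next
    case False
    then have "n - length (shd s) < n" using ne by simp
    from less.IH[OF this, of "stl s"] less.prems stl_sset[of _ s]
    obtain N where "N \<ge> n - length (shd s)" "P (flat (stl s) !! N)" by blast
    then show ?thesis by (subst f) (auto intro!: exI[of _ "length (shd s) + N"])
  qed
qed

lemma directive_index_omega:
  assumes j: "1 \<le> j" "j \<le> m"
    and \<Delta>: "\<Delta> \<in> lang_omega
      (lang_conc (lists (barred_from a m (j + 1)) - {[]}) (lists {Unbarred (a j)} - {[]}))"
  shows "directive_index a m \<Delta> (\<lambda>_. j)"
proof -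
  let ?B = "barred_from a m (j + 1)" and ?Y = "Unbarred (a j)"
  obtain s where s: "s \<in> streams (lang_conc (lists ?B - {[]}) (lists {?Y} - {[]}) - {[]})"
    and \<Delta>_flat: "\<Delta> = flat s"
    using \<Delta> by (auto simp: lang_omega_def)
  have blocks: "\<exists>u v. z = u @ v \<and> u \<noteq> [] \<and> v \<noteq> [] \<and> set u \<subseteq> ?B \<and> set v \<subseteq> {?Y}"
    if "z \<in> sset s" for z
  proof -
    have "z \<in> lang_conc (lists ?B - {[]}) (lists {?Y} - {[]})"
      using streams_sset[OF s] that by blast
    then show ?thesis by (rule lang_concE) (force simp: lists_eq_set)
  qed
  have "\<exists>c\<in>set z. \<exists>x. c = Barred x" "\<exists>c\<in>set z. \<exists>x. c = Unbarred x" if z: "z \<in> sset s" for z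
  proof -
    obtain u v where uv: "z = u @ v" "u \<noteq> []" "v \<noteq> []" "set u \<subseteq> ?B" "set v \<subseteq> {?Y}"
      using blocks[OF z] by blast
    then have "hd u \<in> ?B" "hd v = ?Y" "hd u \<in> set z" "hd v \<in> set z"
      using hd_in_set by fastforce+
    then show "\<exists>c\<in>set z. \<exists>x. c = Barred x" "\<exists>c\<in>set z. \<exists>x. c = Unbarred x"
      by (auto simp: barred_from_def)
  qed
  moreover have "\<Delta> !! n = ?Y \<or> \<Delta> !! n \<in> ?B" for n
  proof -
    have "\<Delta> !! n \<in> (\<Union>z\<in>sset s. set z)"
      using sset_flat[of s] blocks snth_sset[of \<Delta> n] unfolding \<Delta>_flat by blast
    then obtain z where "z \<in> sset s" "\<Delta> !! n \<in> set z" by blast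
    with blocks[OF this(1)] show ?thesis by auto
  qed
  ultimately show ?thesis
    unfolding directive_index_def using j
    by (auto simp: \<Delta>_flat intro: flat_infinitely_often)
qed

lemma lyndon_directives_index:
  assumes "\<Delta> \<in> lyndon_directives a m j" "1 \<le> j" "j < m"
  shows "\<exists>g. directive_index a m \<Delta> g"
proof -
  obtain u \<Delta>' where "\<Delta> = u @- \<Delta>'"
    and u: "u \<in> foldr lang_conc (map (lyndon_block a m) [1..<j + 1]) {[]}"
    and \<Delta>': "\<Delta>' \<in> lang_omega
      (lang_conc (lists (barred_from a m (j + 1)) - {[]}) (lists {Unbarred (a j)} - {[]}))"
    using assms(1) unfolding lyndon_directives_def lang_shift_def by blast
  moreover have "directive_index a m \<Delta>' (\<lambda>_. j)"
    using directive_index_omega[OF _ _ \<Delta>'] assms by simp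
  from directive_index_blocks[OF this _ _ _ u] assms
  have "\<exists>g. directive_index a m (u @- \<Delta>') g" by auto
  ultimately show ?thesis by simp
qed

section \<open>From index functions to the language, and normalization\<close>

lemma next_occurrence:
  assumes "\<exists>N\<ge>n. P N"
  obtains N :: nat where "N \<ge> n" "P N" "\<And>k. n \<le> k \<Longrightarrow> k < N \<Longrightarrow> \<not> P k"
proof -
  let ?Q = "\<lambda>N. N \<ge> n \<and> P N"
  have "?Q (LEAST N. ?Q N)" using assms by (rule LeastI_ex)
  then show thesis using not_less_Least[of _ ?Q] that[of "LEAST N. ?Q N"] by blast
qed

lemma bounded_mono_eventually_const:
  fixes g :: "nat \<Rightarrow> nat"
  assumes "\<And>n. g n \<le> g (Suc n)" "\<And>n. g n \<le> m"
  shows "\<exists>n0. \<forall>n\<ge>n0. g n = g n0"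
proof -
  have fin: "finite (range g)" using assms(2) by (auto intro: finite_subset[of "range g" "{..m}"])
  have "Max (range g) \<in> range g" using fin by (rule Max_in) simp
  then obtain n0 where n0: "g n0 = Max (range g)" by (metis imageE)
  have "g n = g n0" if "n \<ge> n0" for n
    using lift_Suc_mono_le[of g, OF assms(1) that] Max_ge[OF fin, of "g n"] n0 by simp
  then show ?thesis by blast
qed

lemma stake_in_lists:
  assumes "\<And>l. i \<le> l \<Longrightarrow> l < k \<Longrightarrow> s !! l \<in> B"
  shows "stake (k - i) (sdrop i s) \<in> lists B"
  using assms by (auto simp: in_lists_conv_set in_set_conv_nth sdrop_snth)

lemma lyndon_block_append:
  assumes "c \<in> lang_conc (lists (barred_from a m (i + 1))) {[Unbarred (a i)]}"
    and "v \<in> lyndon_block a m i"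
  shows "c @ v \<in> lyndon_block a m i"
proof -
  obtain vs where "v = concat vs"
    "vs \<in> lists (lang_conc (lists (barred_from a m (i + 1))) {[Unbarred (a i)]})"
    using assms(2) by (auto simp: lyndon_block_def lang_star_def)
  then show ?thesis unfolding lyndon_block_def lang_star_def
    using assms(1) by (intro image_eqI[of _ _ "c # vs"]) auto
qed

text \<open>The prefix is parsed backwards from its final unbarred letter at \<open>N\<close>. Since
  \<open>g\<close> is nondecreasing, chunks with larger indices come later, as in the product of
  starred blocks; empty blocks account for indices that are skipped.\<close>

lemma directive_index_prefix:
  assumes di: "directive_index a m \<Delta> g" and N: "\<Delta> !! N = Unbarred y" and j: "g N = j"
  shows "stake (Suc N) \<Delta> \<in> foldr lang_conc (map (lyndon_block a m) [1..<j + 1]) {[]}"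
proof -
  define L where "L i = foldr lang_conc (map (lyndon_block a m) [i..<j + 1]) {[]}" for i
  define C where "C i = lang_conc (lists (barred_from a m (i + 1))) {[Unbarred (a i)]}" for i
  have L_rec: "L i = lang_conc (lyndon_block a m i) (L (Suc i))" if "i \<le> j" for i
    using that by (simp add: L_def upt_conv_Cons del: upt_Suc)
  have Nil: "[] \<in> lyndon_block a m i" for i
    by (auto simp: lyndon_block_def lang_star_def intro: image_eqI[of _ _ "[]"])
  have L_Suc: "L (Suc i) \<subseteq> L i" if "i \<le> j" for i
    using Nil[of i] unfolding L_rec[OF that] lang_conc_def by force
  have L_mono: "L k \<subseteq> L i" if "i \<le> k" "k \<le> j" for i k
    using that(1)
  proof (induction rule: inc_induct)
    case (step i)
    then show ?case using L_Suc[of i] that(2) by auto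
  qed simp
  have C_L: "c @ v \<in> L i" if c: "c \<in> C i" and v: "v \<in> L i" and i: "i \<le> j" for c v i
  proof -
    obtain v1 v2 where "v = v1 @ v2" "v1 \<in> lyndon_block a m i" "v2 \<in> L (Suc i)"
      using v unfolding L_rec[OF i] lang_conc_def by blast
    then show ?thesis
      using lyndon_block_append[OF c[unfolded C_def], of v1] unfolding L_rec[OF i] lang_conc_def
      by (metis (mono_tags, lifting) append.assoc mem_Collect_eq)
  qed
  have g: "1 \<le> g n" "g n \<le> g (Suc n)"
    "\<Delta> !! n = Unbarred (a (g n)) \<or> \<Delta> !! n \<in> barred_from a m (g n + 1) \<and> g (Suc n) = g n" for n
    using di by (auto simp: directive_index_def)
  have g_mono: "g n \<le> g k" if "n \<le> k" for n k using lift_Suc_mono_le[of g, OF g(2) that] .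
  have Unb: "[Unbarred (a i)] \<in> C i" for i by (auto simp: C_def lang_conc_def)
  \<comment> \<open>Invariant: \<open>c\<close> is the chunk running up to the next unbarred letter
    and \<open>v\<close> is already parsed. A barred letter extends \<open>c\<close>; an unbarred
    one forms a new chunk, and \<open>c\<close> joins \<open>v\<close>.\<close>
  have "\<exists>c\<in>C (g n). \<exists>v\<in>L (g n). stake (Suc N - n) (sdrop n \<Delta>) = c @ v" if "n \<le> N" for n
    using that
  proof (induction rule: inc_induct)
    case base
    have "\<Delta> !! N = Unbarred (a j)" using g(3)[of N] N j by (auto simp: barred_from_def)
    moreover have "[] \<in> L j" using L_rec[of j] Nil[of j] by (simp add: L_def lang_conc_def)
    ultimately show ?case using Unb[of j] j by (intro bexI[of _ "[Unbarred (a j)]"] bexI[of _ "[]"]) auto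
  next
    case (step n)
    let ?r = "stake (Suc N - Suc n) (sdrop (Suc n) \<Delta>)"
    have split: "stake (Suc N - n) (sdrop n \<Delta>) = \<Delta> !! n # ?r"
      using step.hyps by (simp add: Suc_diff_le)
    obtain c v where c: "c \<in> C (g (Suc n))" and v: "v \<in> L (g (Suc n))" and r: "?r = c @ v"
      using step.IH by blast
    have le: "g n \<le> g (Suc n)" "g (Suc n) \<le> j"
      using g_mono[of "Suc n" N] g(2)[of n] step.hyps j by auto
    show ?case using g(3)[of n]
    proof
      assume u: "\<Delta> !! n = Unbarred (a (g n))"
      have "c @ v \<in> L (g n)" using C_L[OF c v le(2)] L_mono[OF le] by blast
      then show ?thesis unfolding split r u
        by (intro bexI[of _ "[Unbarred (a (g n))]"] bexI[of _ "c @ v"] Unb) simp_all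
    next
      assume b: "\<Delta> !! n \<in> barred_from a m (g n + 1) \<and> g (Suc n) = g n"
      then have "\<Delta> !! n # c \<in> C (g n)" 
        using c unfolding C_def
        by (elim lang_concE) (metis (no_types, lifting) append_Cons lang_concI lists.Cons)
      then show ?thesis unfolding split r using v b
        by (intro bexI[of _ "\<Delta> !! n # c"] bexI[of _ v]) simp_all
    qed
  qed
  from this[of 0] obtain c v where "c \<in> C (g 0)" "v \<in> L (g 0)" "stake (Suc N) \<Delta> = c @ v" by auto
  moreover have "g 0 \<le> j" using g_mono[of 0 N] j by simp
  ultimately have "stake (Suc N) \<Delta> \<in> L (g 0)" using C_L by metis
  then show ?thesis using L_mono[of 1 "g 0"] g(1)[of 0] \<open>g 0 \<le> j\<close> by (auto simp: L_def)
qed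

lemma directive_index_lyndon_directives:
  assumes di: "directive_index a m \<Delta> g"
  shows "\<exists>j. 1 \<le> j \<and> j < m \<and> \<Delta> \<in> lyndon_directives a m j"
proof -
  have g: "1 \<le> g n" "g n \<le> m" "g n \<le> g (Suc n)"
    "\<Delta> !! n = Unbarred (a (g n)) \<or> \<Delta> !! n \<in> barred_from a m (g n + 1)" for n
    using di by (auto simp: directive_index_def)
  have inf_B: "\<exists>N\<ge>n. \<exists>x. \<Delta> !! N = Barred x" and inf_U: "\<exists>N\<ge>n. \<exists>x. \<Delta> !! N = Unbarred x" for n
    using di by (auto simp: directive_index_def)
  obtain n0 where const: "\<And>n. n \<ge> n0 \<Longrightarrow> g n = g n0"
    using bounded_mono_eventually_const[of g m] g by blast
  define j where "j = g n0"
  let ?B = "barred_from a m (j + 1)" and ?Y = "Unbarred (a j)"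
  have letter: "\<Delta> !! n = ?Y \<or> \<Delta> !! n \<in> ?B" if "n \<ge> n0" for n
    using g(4)[of n] const[OF that] by (simp add: j_def)
  \<comment> \<open>From \<open>n0\<close> on the index is constantly \<open>j\<close>. The cut
    \<open>N\<close> is the first barred position after an unbarred one: the prefix then ends in an
    unbarred letter, the tail starts with a barred one, and this barred letter has index above
    \<open>j\<close>, which forces \<open>j < m\<close>.\<close>
  obtain M where M: "M \<ge> n0" "\<exists>x. \<Delta> !! M = Unbarred x" using inf_U by blast
  obtain N where N: "N \<ge> M" "\<exists>x. \<Delta> !! N = Barred x"
    "\<And>k. M \<le> k \<Longrightarrow> k < N \<Longrightarrow> \<not> (\<exists>x. \<Delta> !! k = Barred x)"
    using next_occurrence[OF inf_B[of M]] by blast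
  have "N \<noteq> M" using M(2) N(2) by auto
  then obtain K where K: "N = Suc K" "K \<ge> M" using N(1) by (cases N) auto
  obtain y where y: "\<Delta> !! K = Unbarred y" using N(3)[of K] K by (cases "\<Delta> !! K") auto
  have "\<Delta> !! N \<in> ?B" using letter[of N] N M by auto
  then have "j < m" by (auto simp: barred_from_def)
  have "g K = j" using const[of K] K M by (simp add: j_def)
  then have prefix: "stake N \<Delta> \<in> foldr lang_conc (map (lyndon_block a m) [1..<j + 1]) {[]}"
    using directive_index_prefix[OF di y] K by simp
  let ?K = "lang_conc (lists ?B - {[]}) (lists {?Y} - {[]})"
  have "\<exists>t\<in>streams (?K - {[]}). sdrop N \<Delta> = flat (smap (\<lambda>v. v) t)"
  proof (rule flat_smap_unfoldI[of "{sdrop i \<Delta> | i. i \<ge> n0 \<and> (\<exists>x. \<Delta> !! i = Barred x)}"])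
    show "sdrop N \<Delta> \<in> {sdrop i \<Delta> | i. i \<ge> n0 \<and> (\<exists>x. \<Delta> !! i = Barred x)}"
      using N M by auto
  next
    fix s assume "s \<in> {sdrop i \<Delta> | i. i \<ge> n0 \<and> (\<exists>x. \<Delta> !! i = Barred x)}"
    then obtain i where s: "s = sdrop i \<Delta>" and i: "i \<ge> n0" "\<exists>x. \<Delta> !! i = Barred x" by blast
    \<comment> \<open>One block of the omega power: the barred run up to \<open>p\<close>, then the
      unbarred run up to \<open>q\<close>.\<close>
    obtain p where p: "p \<ge> i" "\<exists>x. \<Delta> !! p = Unbarred x"
      "\<And>k. i \<le> k \<Longrightarrow> k < p \<Longrightarrow> \<not> (\<exists>x. \<Delta> !! k = Unbarred x)"
      using next_occurrence[OF inf_U[of i]] by blast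
    obtain q where q: "q \<ge> p" "\<exists>x. \<Delta> !! q = Barred x"
      "\<And>k. p \<le> k \<Longrightarrow> k < q \<Longrightarrow> \<not> (\<exists>x. \<Delta> !! k = Barred x)"
      using next_occurrence[OF inf_B[of p]] by blast
    have "p \<noteq> i" "q \<noteq> p" using i p q by auto
    let ?u = "stake (p - i) (sdrop i \<Delta>)" and ?v = "stake (q - p) (sdrop p \<Delta>)"
    have "?u \<in> lists ?B"
    proof (rule stake_in_lists)
      fix l assume "i \<le> l" "l < p"
      then show "\<Delta> !! l \<in> ?B" using letter[of l] p(3)[of l] i by auto
    qed
    moreover have "?v \<in> lists {?Y}"
    proof (rule stake_in_lists)
      fix l assume "p \<le> l" "l < q"
      then show "\<Delta> !! l \<in> {?Y}" using letter[of l] q(3)[of l] p i by (auto simp: barred_from_def)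
    qed
    moreover have "?u \<noteq> []" "?v \<noteq> []" using \<open>p \<noteq> i\<close> \<open>q \<noteq> p\<close> p(1) q(1) by auto
    ultimately have "?u @ ?v \<in> ?K - {[]}" unfolding lang_conc_def by blast
    moreover have "sdrop p \<Delta> = ?v @- sdrop q \<Delta>"
      using stake_sdrop[of "q - p" "sdrop p \<Delta>"] q(1) by simp
    then have "s = (?u @ ?v) @- sdrop q \<Delta>"
      using stake_sdrop[of "p - i" "sdrop i \<Delta>"] p(1) by (simp add: s)
    moreover have "q \<ge> n0" using i p q by simp
    ultimately show "\<exists>c\<in>?K - {[]}. c \<noteq> [] \<and>
        (\<exists>s'\<in>{sdrop i \<Delta> | i. i \<ge> n0 \<and> (\<exists>x. \<Delta> !! i = Barred x)}. s = c @- s')"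
      using q(2) by blast
  qed
  then have "sdrop N \<Delta> \<in> lang_omega ?K"
    by (auto simp: lang_omega_def stream.map_ident)
  with prefix have "\<Delta> \<in> lyndon_directives a m j"
    unfolding lyndon_directives_def lang_shift_def by (metis (mono_tags, lifting) mem_Collect_eq stake_sdrop)
  then show ?thesis using \<open>j < m\<close> g(1)[of n0] by (auto simp: j_def)
qed

text \<open>Along a barred run \<open>g\<close> is constant, so the unbarred letter that ends the
  run has index \<open>g i\<close>, while the barred letter opening it has a larger index.\<close>

lemma directive_index_normalized:
  assumes di: "directive_index a m \<Delta> g" and inj: "inj_on a {1..m}"
    and v: "v \<in> lists (range Barred)"
  shows "[Barred c] @ v @ [Unbarred c] \<notin> factors \<Delta>"
proof
  have g: "1 \<le> g n" "g n \<le> m"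
    "\<Delta> !! n = Unbarred (a (g n)) \<or> \<Delta> !! n \<in> barred_from a m (g n + 1) \<and> g (Suc n) = g n" for n
    using di by (auto simp: directive_index_def)
  assume "[Barred c] @ v @ [Unbarred c] \<in> factors \<Delta>"
  then obtain i s where i: "sdrop i \<Delta> = (Barred c # v) @- Unbarred c ## s"
    by (auto simp: factors_iff)
  have nth: "\<Delta> !! (i + k) = ((Barred c # v) @- Unbarred c ## s) !! k" for k
    unfolding i[symmetric] by (simp add: sdrop_snth)
  have const: "g (i + k) = g i" if "k \<le> Suc (length v)" for k
    using that
  proof (induction k)
    case (Suc k)
    then have "\<Delta> !! (i + k) \<in> range Barred"
      using v unfolding nth by (cases k) (auto simp: in_lists_conv_set)
    then show ?case using g(3)[of "i + k"] Suc by auto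
  qed simp
  have "\<Delta> !! (i + Suc (length v)) = Unbarred c" unfolding nth by simp
  then have "c = a (g i)" using g(3)[of "i + Suc (length v)"] const[of "Suc (length v)"]
    by (auto simp: barred_from_def)
  moreover have "\<Delta> !! i = Barred c" using nth[of 0] by simp
  then obtain k where "g i + 1 \<le> k" "k \<le> m" "c = a k"
    using g(3)[of i] by (auto simp: barred_from_def)
  ultimately show False using inj_onD[OF inj, of "g i" k] g(1)[of i] g(2)[of i] by auto
qed

section \<open>Lyndon episturmian words\<close>

lemma directed_lyndon:
  fixes a :: "nat \<Rightarrow> 'a::linorder"
  assumes mono: "strict_mono_on {1..m} a" and di: "directive_index a m \<Delta> g"
    and "directs A \<Delta> w"
  shows "infinite_lyndon w"
proof -
  obtain T where T0: "T 0 = w" and T: "\<And>n. T n = apply_morph (mu (\<Delta> !! n)) (T (Suc n))"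
    using assms(3) unfolding directs_def by blast
  have g: "1 \<le> g n" "g n \<le> m" "g n \<le> g (Suc n)" for n
    using di by (auto simp: directive_index_def)
  have inf_B: "\<exists>N\<ge>n. \<exists>x. \<Delta> !! N = Barred x" and inf_U: "\<exists>N\<ge>n. \<exists>x. \<Delta> !! N = Unbarred x" for n
    using di by (auto simp: directive_index_def)
  have a_le: "a (g n) \<le> a (g k)" if "n \<le> k" for n k
    using strict_mono_onD[OF mono, of "g n" "g k"] lift_Suc_mono_le[of g, OF g(3) that] g(1,2)[of n] g(1,2)[of k]
    by (cases "g n = g k") auto
  have cases: "(\<Delta> !! n = Unbarred (a (g n)) \<and> T n = a (g n) ## R_stream (a (g n)) (T (Suc n))) \<or>
    (\<exists>x. \<Delta> !! n = Barred x \<and> a (g n) < x \<and> g (Suc n) = g n \<and> T n = R_stream x (T (Suc n)))" for n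
  proof -
    have "\<Delta> !! n = Unbarred (a (g n)) \<or>
        (\<Delta> !! n \<in> barred_from a m (g n + 1) \<and> g (Suc n) = g n)"
      using di by (auto simp: directive_index_def)
    then show ?thesis
    proof
      assume u: "\<Delta> !! n = Unbarred (a (g n))"
      show ?thesis using T[of n] u unfolding u mu_stream by simp
    next
      assume b: "\<Delta> !! n \<in> barred_from a m (g n + 1) \<and> g (Suc n) = g n"
      then obtain k where k: "g n + 1 \<le> k" "k \<le> m" "\<Delta> !! n = Barred (a k)"
        by (auto simp: barred_from_def)
      then have "a (g n) < a k" using strict_mono_onD[OF mono, of "g n" k] g(1)[of n] by auto
      then show ?thesis using T[of n] b k(3) unfolding k(3) mu_stream by simp
    qed
  qed
  \<comment> \<open>Barred levels keep both the first letter and the index; the next unbarred level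
    shows what that letter is.\<close>
  have shd_T: "shd (T n) = a (g n)" for n
  proof -
    obtain N where N: "N \<ge> n" "\<exists>x. \<Delta> !! N = Unbarred x" using inf_U by blast
    from N(1) show ?thesis
    proof (induction rule: inc_induct)
      case base
      then show ?case using cases[of N] N(2) by auto
    next
      case (step n)
      then show ?case using cases[of n] by auto
    qed
  qed
  have min_T: "a (g n) \<le> T n !! p" for n p
  proof (rule ccontr)
    assume "\<not> ?thesis"
    then have lt: "T n !! p < a (g n)" by simp
    \<comment> \<open>A letter that is too small lies below every later \<open>a (g k)\<close>, so
      it differs from all later directive letters and survives at every level. Each unbarred level
      strips a leading letter and so moves it to the left.\<close>
    define Q where "Q k q \<longleftrightarrow> n \<le> k \<and> T k !! q = T n !! p" for k q
    have "\<not> Q n p"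
    proof (rule no_infinite_descent[where S = "\<lambda>k. \<exists>x. \<Delta> !! k = Unbarred x"])
      fix k q assume "Q k q"
      then have nk: "n \<le> k" and q: "T k !! q = T n !! p" by (auto simp: Q_def)
      have lt': "T n !! p < a (g k)" using lt a_le[OF nk] by simp
      show "\<exists>q'\<le>q. Q (Suc k) q' \<and> ((\<exists>x. \<Delta> !! k = Unbarred x) \<longrightarrow> q' < q)"
        using cases[of k]
      proof (elim disjE exE conjE)
        assume e: "T k = a (g k) ## R_stream (a (g k)) (T (Suc k))"
        obtain q0 where q0: "q = Suc q0" using q lt' e by (cases q) auto
        have "R_stream (a (g k)) (T (Suc k)) !! q0 = T n !! p" "T n !! p \<noteq> a (g k)"
          using q lt' by (simp_all add: e q0)
        from R_stream_letter[OF this] obtain q' where "q' \<le> q0" "T (Suc k) !! q' = T n !! p" by auto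
        then show ?thesis using nk by (intro exI[of _ q']) (simp add: Q_def q0)
      next
        fix x assume x: "\<Delta> !! k = Barred x" "a (g k) < x" and e: "T k = R_stream x (T (Suc k))"
        have "R_stream x (T (Suc k)) !! q = T n !! p" "T n !! p \<noteq> x"
          using q e lt' x(2) by auto
        from R_stream_letter[OF this] obtain q' where "q' \<le> q" "T (Suc k) !! q' = T n !! p" by auto
        then show ?thesis using nk x(1) by (intro exI[of _ q']) (simp add: Q_def)
      qed
    qed (rule inf_U)
    then show False by (simp add: Q_def)
  qed
  define Q where "Q n k \<longleftrightarrow> k > 0 \<and> \<not> lex_less (T n) (sdrop k (T n))" for n k
  have preimage: "\<not> lex_less (T (Suc n)) (sdrop k' (T (Suc n)))"
    if "Q n k" "sdrop k (T n) = apply_morph (mu (\<Delta> !! n)) (sdrop k' (T (Suc n)))" for n k k'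
    using that lex_less_mu T unfolding Q_def by metis
  have "\<not> Q 0 k" for k
  proof (rule no_infinite_descent[where S = "\<lambda>n. \<exists>x. \<Delta> !! n = Barred x"])
    fix n k assume Q: "Q n k"
    then have k: "k > 0" "\<not> lex_less (T n) (sdrop k (T n))" by (auto simp: Q_def)
    \<comment> \<open>A suffix that is not larger must start with the minimal letter. At a barred
      level it therefore cannot start at the trailing \<open>x\<close> of a block, as
      \<open>x\<close> is larger.\<close>
    have head: "shd (sdrop k (T n)) = a (g n)"
      using lex_less_shd[of "T n" "sdrop k (T n)"] k(2) shd_T[of n] min_T[of n k] by force
    show "\<exists>k'\<le>k. Q (Suc n) k' \<and> ((\<exists>x. \<Delta> !! n = Barred x) \<longrightarrow> k' < k)"
      using cases[of n]
    proof (elim disjE exE conjE)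
      let ?y = "a (g n)"
      assume u: "\<Delta> !! n = Unbarred ?y" and e: "T n = ?y ## R_stream ?y (T (Suc n))"
      obtain p where p: "k = Suc p" using k(1) by (cases k) auto
      have drop: "sdrop k (T n) = sdrop p (R_stream ?y (T (Suc n)))" by (simp add: e p)
      \<comment> \<open>The leading \<open>?y\<close> is either a whole block of the R-image or
        closes one. In both cases the suffix is the L-image of a proper suffix of the next word;
        \<open>Suc q\<close> stays within \<open>k\<close> because \<open>k = Suc p\<close>.\<close>
      obtain k' where k': "0 < k'" "k' \<le> k" "sdrop k (T n) = ?y ## R_stream ?y (sdrop k' (T (Suc n)))"
        using sdrop_R_stream[of p ?y "T (Suc n)"]
      proof (elim disjE exE conjE)
        fix q assume q: "q \<le> p" and R: "sdrop p (R_stream ?y (T (Suc n))) = R_stream ?y (sdrop q (T (Suc n)))"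
        have "T (Suc n) !! q = ?y" using head unfolding drop R by simp
        then have "sdrop q (T (Suc n)) = ?y ## sdrop (Suc q) (T (Suc n))"
          by (metis sdrop_simps stream.collapse)
        then have "sdrop k (T n) = ?y ## R_stream ?y (sdrop (Suc q) (T (Suc n)))"
          unfolding drop R by (simp only: R_stream_Cons R_morph_simps shift.simps)
        then show thesis using that[of "Suc q"] q p by simp
      next
        fix q assume "q \<le> p" "0 < q"
          "sdrop p (R_stream ?y (T (Suc n))) = ?y ## R_stream ?y (sdrop q (T (Suc n)))"
        then show thesis using that[of q] p unfolding drop by simp
      qed
      then have "\<not> lex_less (T (Suc n)) (sdrop k' (T (Suc n)))"
        by (intro preimage[OF Q]) (simp only: u mu_stream)
      then show ?thesis using k' u by (intro exI[of _ k']) (simp add: Q_def)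
    next
      fix x assume x: "\<Delta> !! n = Barred x" "a (g n) < x" and gn: "g (Suc n) = g n"
        and e: "T n = R_stream x (T (Suc n))"
      \<comment> \<open>The first block thus has length two, which is what makes the position
        decrease strictly at barred levels.\<close>
      have ne: "shd (T (Suc n)) \<noteq> x" using shd_T[of "Suc n"] gn x(2) by simp
      show ?thesis using sdrop_R_stream[of k x "T (Suc n)"]
      proof (elim disjE exE conjE)
        fix q assume q: "k > 0 \<longrightarrow> q > 0" "k > 0 \<longrightarrow> shd (T (Suc n)) \<noteq> x \<longrightarrow> q < k"
          "sdrop k (R_stream x (T (Suc n))) = R_stream x (sdrop q (T (Suc n)))"
        then have "sdrop k (T n) = R_stream x (sdrop q (T (Suc n)))" using e by simp
        then have "\<not> lex_less (T (Suc n)) (sdrop q (T (Suc n)))"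
          by (intro preimage[OF Q]) (simp only: x mu_stream)
        then show ?thesis using q k(1) ne by (intro exI[of _ q]) (simp add: Q_def)
      next
        fix q assume "sdrop k (R_stream x (T (Suc n))) = x ## R_stream x (sdrop q (T (Suc n)))"
        then show ?thesis using head x(2) e by simp
      qed
    qed
  qed (rule inf_B)
  then show ?thesis unfolding Q_def T0 infinite_lyndon_def by blast
qed

lemma lyndon_directive_exists:
  fixes a :: "nat \<Rightarrow> 'a::linorder"
  assumes mono: "strict_mono_on {1..m} a" and A: "A = a ` {1..m}" and w: "w \<in> streams A"
    and epi: "episturmian w" and lyn: "infinite_lyndon w"
  shows "\<exists>\<Delta> g. normalized_directive A \<Delta> w \<and> directive_index a m \<Delta> g"
proof -
  define step where "step \<sigma> s t \<longleftrightarrow> s = apply_morph (mu \<sigma>) t \<and>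
    (\<sigma> = Unbarred (shd s) \<or> (\<exists>x\<in>A. shd s < x \<and> \<sigma> = Barred x \<and> shd t = shd s))" for \<sigma> and s t :: "'a stream"
  \<comment> \<open>The clause for \<open>n = 0\<close> makes the dependent choice start at
    \<open>w\<close>.\<close>
  have "\<exists>T. \<forall>n. (T n \<in> streams A \<and> episturmian (T n) \<and> infinite_lyndon (T n) \<and> (n = 0 \<longrightarrow> T n = w)) \<and>
      (\<exists>\<sigma>. step \<sigma> (T n) (T (Suc n)))"
  proof (rule dependent_nat_choice)
    fix s and n :: nat assume "s \<in> streams A \<and> episturmian s \<and> infinite_lyndon s \<and> (n = 0 \<longrightarrow> s = w)"
    then obtain \<sigma> t where "step \<sigma> s t" "t \<in> streams A" "episturmian t" "infinite_lyndon t"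
      using episturmian_lyndon_step[of s A] unfolding step_def by blast
    then show "\<exists>t. (t \<in> streams A \<and> episturmian t \<and> infinite_lyndon t \<and> (Suc n = 0 \<longrightarrow> t = w)) \<and>
        (\<exists>\<sigma>. step \<sigma> s t)" by blast
  qed (use w epi lyn in blast)
  then obtain T where T: "\<And>n. T n \<in> streams A" "\<And>n. episturmian (T n)" "\<And>n. infinite_lyndon (T n)"
    and T0: "T 0 = w" and "\<forall>n. \<exists>\<sigma>. step \<sigma> (T n) (T (Suc n))" by metis
  then obtain \<sigma> where \<sigma>: "\<And>n. step (\<sigma> n) (T n) (T (Suc n))" by metis
  define \<Delta> where "\<Delta> = smap \<sigma> nats"
  have \<Delta>: "\<Delta> !! n = \<sigma> n" for n by (simp add: \<Delta>_def)
  have "\<forall>n. \<exists>k. k \<in> {1..m} \<and> a k = shd (T n)"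
    using streams_shd[OF T(1)] unfolding A by (metis imageE)
  then obtain g where g: "\<And>n. g n \<in> {1..m}" and ag: "\<And>n. a (g n) = shd (T n)" by metis
  have less: "k < l" if "a k < a l" "k \<in> {1..m}" "l \<in> {1..m}" for k l
    using that strict_mono_onD[OF mono, of l k] by (metis less_asym linorder_neqE_nat order_less_irrefl)
  have mu_T: "T n = apply_morph (mu (\<Delta> !! n)) (T (Suc n))" for n
    using \<sigma>[of n] by (simp add: step_def \<Delta>)
  have cases: "(\<Delta> !! n = Unbarred (a (g n)) \<and> T n = a (g n) ## R_stream (a (g n)) (T (Suc n))) \<or>
    (\<exists>k\<in>{g n + 1..m}. \<Delta> !! n = Barred (a k) \<and> shd (T (Suc n)) = shd (T n) \<and>
       shd (T n) \<noteq> a k \<and> T n = R_stream (a k) (T (Suc n)))" for n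
  proof (cases "\<Delta> !! n = Unbarred (a (g n))")
    case True
    then show ?thesis using mu_T[of n] unfolding True mu_stream by simp
  next
    case False
    then have "\<exists>x\<in>A. a (g n) < x \<and> \<Delta> !! n = Barred x \<and> shd (T (Suc n)) = shd (T n)"
      using \<sigma>[of n] unfolding step_def \<Delta> ag by blast
    then obtain k where k: "k \<in> {1..m}" "a (g n) < a k" "\<Delta> !! n = Barred (a k)"
      "shd (T (Suc n)) = shd (T n)" unfolding A by blast
    have "k \<in> {g n + 1..m}" using less[OF k(2) g k(1)] k(1) by simp
    moreover have "shd (T n) \<noteq> a k" using k(2) ag[of n] by simp
    moreover have "T n = R_stream (a k) (T (Suc n))" using mu_T[of n] unfolding k(3) mu_stream .
    ultimately show ?thesis using k(3,4) by blast
  qed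
  have g_le: "g n \<le> g (Suc n)" for n
  proof -
    \<comment> \<open>The letters of \<open>T (Suc n)\<close> occur in \<open>T n\<close>, whose
      first letter is its smallest; hence first letters never decrease.\<close>
    have "shd (T (Suc n)) \<in> sset (T n)"
      using cases[of n] shd_sset[of "T (Suc n)"] sset_R_stream[of "T (Suc n)"]
      by (metis (no_types, lifting) in_mono insertI2 stream.simps(8))
    then have "a (g n) \<le> a (g (Suc n))"
      using infinite_lyndon_shd_le[OF T(3)] unfolding ag sset_range by auto
    then show ?thesis using strict_mono_onD[OF mono, of "g (Suc n)" "g n"] g[of n] g[of "Suc n"]
      by (metis leI not_le)
  qed
  have inf_U: "\<exists>N\<ge>n. \<exists>x. \<Delta> !! N = Unbarred x" for n
  proof (rule ccontr)
    assume no: "\<not> ?thesis"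
    \<comment> \<open>If only barred letters followed, the first letter would stay the same and
      always have a block of length two. A second occurrence of it, supplied by recurrence, would
      then move left at every level.\<close>
    define Q where "Q k p \<longleftrightarrow> n \<le> k \<and> p > 0 \<and> T k !! p = shd (T k)" for k p
    have "\<not> Q n p" for p
    proof (rule no_infinite_descent[where S = "\<lambda>_. True"])
      fix k p assume "Q k p"
      then have k: "n \<le> k" "p > 0" "T k !! p = shd (T k)" by (auto simp: Q_def)
      obtain x where x: "shd (T (Suc k)) = shd (T k)" "shd (T k) \<noteq> x" "T k = R_stream x (T (Suc k))"
        using cases[of k] no k(1) by blast
      have "R_stream x (T (Suc k)) !! p = shd (T k)" using x(3) k(3) by simp
      from R_stream_letter[OF this x(2)] show "\<exists>p'\<le>p. Q (Suc k) p' \<and> (True \<longrightarrow> p' < p)"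
        using k x(1,2) by (auto simp: Q_def)
    qed auto
    moreover have "sdrop 0 (T n) = [shd (T n)] @- stl (T n)" by simp
    then have "[shd (T n)] \<in> factors (T n)" by (rule factorsI)
    from recurrentD[OF episturmian_recurrent[OF T(2)] this, of 1]
    obtain p s where p: "p \<ge> 1" "sdrop p (T n) = [shd (T n)] @- s" by blast
    have "T n !! p = shd (T n)" using sdrop_simps(1)[of p "T n"] unfolding p(2) by simp
    then have "Q n p" using p(1) by (simp add: Q_def)
    ultimately show False by blast
  qed
  obtain n0 where n0: "\<And>n. n \<ge> n0 \<Longrightarrow> g n = g n0"
    using bounded_mono_eventually_const[of g m] g_le g by fastforce
  have inf_B: "\<exists>N\<ge>n. \<exists>x. \<Delta> !! N = Barred x" for n
  proof (rule ccontr)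
    assume no: "\<not> ?thesis"
    \<comment> \<open>From \<open>n1\<close> on every step would be L with the same letter
      \<open>y\<close>. Any other letter would move left at every level, so \<open>T n1\<close>
      consists of \<open>y\<close> only and equals its proper suffixes, contrary to the Lyndon
      property.\<close>
    define n1 where "n1 = max n n0"
    define y where "y = a (g n0)"
    define Q where "Q k p \<longleftrightarrow> n1 \<le> k \<and> T k !! p \<noteq> y" for k p
    have "\<not> Q n1 p" for p
    proof (rule no_infinite_descent[where S = "\<lambda>_. True"])
      fix k p assume "Q k p"
      then have k: "n1 \<le> k" "T k !! p \<noteq> y" by (auto simp: Q_def)
      have "a (g k) = y" using n0[of k] k(1) by (simp add: y_def n1_def)
      moreover have "n \<le> k" using k(1) by (simp add: n1_def)
      ultimately have e: "T k = y ## R_stream y (T (Suc k))" using cases[of k] no by blast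
      obtain p0 where p0: "p = Suc p0" using k(2) by (cases p) (auto simp: e)
      have "R_stream y (T (Suc k)) !! p0 \<noteq> y" using k(2) by (simp add: e p0)
      from R_stream_letter[OF refl this] this
      obtain p' where "p' \<le> p0" "T (Suc k) !! p' \<noteq> y" by metis
      then show "\<exists>p'\<le>p. Q (Suc k) p' \<and> (True \<longrightarrow> p' < p)"
        using k(1) by (intro exI[of _ p']) (simp add: Q_def p0)
    qed auto
    then have "T n1 !! p = y" for p by (auto simp: Q_def)
    then have "sdrop 1 (T n1) = T n1" unfolding stream_eq_iff_snth sdrop_snth by metis
    moreover have "lex_less (T n1) (sdrop 1 (T n1))" 
      using T(3)[of n1] zero_less_one unfolding infinite_lyndon_def by blast
    ultimately show False using lex_less_asym by metis
  qed
  have "\<Delta> !! n = Unbarred (a (g n)) \<or> \<Delta> !! n \<in> barred_from a m (g n + 1) \<and> g (Suc n) = g n" for n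
    using cases[of n]
  proof (elim disjE bexE conjE)
    fix k assume k: "k \<in> {g n + 1..m}" "\<Delta> !! n = Barred (a k)" and "shd (T (Suc n)) = shd (T n)"
    then have "a (g (Suc n)) = a (g n)" by (simp add: ag)
    then have "g (Suc n) = g n"
      using inj_onD[OF strict_mono_on_imp_inj_on[OF mono]] g by blast
    then show ?thesis using k by (auto simp: barred_from_def)
  qed simp
  then have di: "directive_index a m \<Delta> g"
    unfolding directive_index_def using g g_le inf_B inf_U by fastforce
  have letters: "\<Delta> !! n \<in> spinned_alphabet A" for n
    using cases[of n] g[of n] by (auto simp: spinned_alphabet_def A)
  have "directs A \<Delta> w"
    unfolding directs_def
  proof (intro conjI exI[of _ T] allI)
    show "\<Delta> \<in> streams (spinned_alphabet A)" using letters by (simp add: streams_iff_snth)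
    show "recurrent (T n)" for n by (rule episturmian_recurrent[OF T(2)])
    show "T n = apply_morph (mu (\<Delta> !! n)) (T (Suc n))" for n by (rule mu_T)
  qed (use T0 T(1) in auto)
  moreover have "infinite {n. \<Delta> !! n \<in> Unbarred ` A}"
    unfolding infinite_nat_iff_unbounded_le
  proof
    fix n
    obtain N x where "N \<ge> n" "\<Delta> !! N = Unbarred x" using inf_U by blast
    then show "\<exists>N\<ge>n. N \<in> {n. \<Delta> !! n \<in> Unbarred ` A}"
      using letters[of N] by (auto simp: spinned_alphabet_def)
  qed
  moreover have "[Barred c] @ v @ [Unbarred c] \<notin> factors \<Delta>" if "v \<in> lists (Barred ` A)" for c v
    using that lists_mono[of "Barred ` A" "range Barred"]
    by (intro directive_index_normalized[OF di strict_mono_on_imp_inj_on[OF mono]]) auto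
  ultimately have "normalized_directive A \<Delta> w" by (simp add: normalized_directive_def)
  then show ?thesis using di by blast
qed

theorem theorem6p1:
  fixes a :: "nat \<Rightarrow> 'a::linorder" and m :: nat and A :: "'a set" and w :: "'a stream"
  assumes "m \<ge> 2"
    and "strict_mono_on {1..m} a"
    and "A = a ` {1..m}"
    and "w \<in> streams A"
    and "episturmian w"
  shows "infinite_lyndon w \<longleftrightarrow>
    (\<exists>j. 1 \<le> j \<and> j < m \<and>
      (\<exists>\<Delta>. normalized_directive A \<Delta> w \<and> \<Delta> \<in> lyndon_directives a m j))"
proof
  assume "infinite_lyndon w"
  then obtain \<Delta> g where "normalized_directive A \<Delta> w" "directive_index a m \<Delta> g"
    using lyndon_directive_exists[OF assms(2-5)] by blast
  then show "\<exists>j. 1 \<le> j \<and> j < m \<and>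
      (\<exists>\<Delta>. normalized_directive A \<Delta> w \<and> \<Delta> \<in> lyndon_directives a m j)"
    using directive_index_lyndon_directives by blast
next
  assume "\<exists>j. 1 \<le> j \<and> j < m \<and>
      (\<exists>\<Delta>. normalized_directive A \<Delta> w \<and> \<Delta> \<in> lyndon_directives a m j)"
  then obtain \<Delta> g where "directs A \<Delta> w" "directive_index a m \<Delta> g"
    using lyndon_directives_index unfolding normalized_directive_def by metis
  then show "infinite_lyndon w" using directed_lyndon[OF assms(2)] by blast
qed

end
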